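(* Let $n$ be a positive integer such that a Hadamard matrix of order $n$ exists. Then: (i) there exists a symmetric $(1,-1)$-matrix $M$ of order $n(n-1)$ whose rows can be partitioned into $n-1$ classes of $n$ rows each such that, for the normalized rows (rows divided by their Euclidean norm $\sqrt{n(n-1)}$), $|\langle u,v\rangle|=\frac{1}{n-1}$ for any two distinct rows $u,v$ in the same class and $|\langle u,v\rangle|=0$ for any two rows in different classes (i.e. a symmetric regular biangular matrix with angles $\{0,\frac1{n-1}\}$); (ii) there exists a $(1,-1)$-matrix $M$ of order $n(n-1)$ with the same property, where the classes are the $n-1$ consecutive blocks of $n$ rows, and which is skew-symmetric in the sense that, writing $M=(M_{ij})_{i,j=1}^{n-1}$ with $n\times n$ blocks according to these classes, $M_{ij}^T=-M_{ji}$ for all distinct $i,j$.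
   Context: A Hadamard matrix of order $n$ is an $n\times n$ $(1,-1)$-matrix $H$ with $HH^T=nI_n$. An $(\alpha,\beta)$-biangular matrix is a $(1,-1)$-matrix whose normalized rows have pairwise inner products (in absolute value) in $\{\alpha,\beta\}$; it is regular if its rows can be partitioned into classes of equal size so that one of the two values occurs for pairs within a class and the other for pairs in different classes. *)

theory Defs
  imports
    Complex_Main
    "HOL-Library.Disjoint_Sets"
    "Jordan_Normal_Form.Matrix"
    "Jordan_Normal_Form.DL_Submatrix"
begin

definition pm1_mat :: "real mat \<Rightarrow> bool" where
  "pm1_mat M \<longleftrightarrow> elements_mat M \<subseteq> {1, - 1}"

definition hadamard_mat :: "nat \<Rightarrow> real mat \<Rightarrow> bool" where
  "hadamard_mat n H \<longleftrightarrow>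
     H \<in> carrier_mat n n \<and> pm1_mat H \<and> H * transpose_mat H = real n \<cdot>\<^sub>m 1\<^sub>m n"

definition normalized_row :: "real mat \<Rightarrow> nat \<Rightarrow> real vec" where
  "normalized_row M i = (1 / sqrt (row M i \<bullet> row M i)) \<cdot>\<^sub>v row M i"

definition row_angle :: "real mat \<Rightarrow> nat \<Rightarrow> nat \<Rightarrow> real" where
  "row_angle M i j = \<bar>normalized_row M i \<bullet> normalized_row M j\<bar>"

definition biangular :: "real \<Rightarrow> real \<Rightarrow> real mat \<Rightarrow> bool" where
  "biangular \<alpha> \<beta> M \<longleftrightarrow> pm1_mat M \<and>
     (\<forall>i < dim_row M. \<forall>j < dim_row M. i \<noteq> j \<longrightarrow> row_angle M i j \<in> {\<alpha>, \<beta>})"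

(* Rows are identified with their indices, so that equal rows at different positions
   count as distinct rows. P is the set of classes, s their common size; \<alpha> is the value
   attained within a class and \<beta> the value attained between different classes. *)
definition regular_biangular ::
    "nat set set \<Rightarrow> nat \<Rightarrow> real \<Rightarrow> real \<Rightarrow> real mat \<Rightarrow> bool" where
  "regular_biangular P s \<alpha> \<beta> M \<longleftrightarrow>
     biangular \<alpha> \<beta> M \<and>
     partition_on {..<dim_row M} P \<and>
     (\<forall>C \<in> P. card C = s) \<and>
     (\<forall>C \<in> P. \<forall>i \<in> C. \<forall>j \<in> C. i \<noteq> j \<longrightarrow> row_angle M i j = \<alpha>) \<and>
     (\<forall>C \<in> P. \<forall>D \<in> P. C \<noteq> D \<longrightarrow> (\<forall>i \<in> C. \<forall>j \<in> D. row_angle M i j = \<beta>))"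

(* Blocks are counted from 0. *)
definition index_block :: "nat \<Rightarrow> nat \<Rightarrow> nat set" where
  "index_block n i = {i * n ..< (i + 1) * n}"

definition mat_block :: "nat \<Rightarrow> 'a mat \<Rightarrow> nat \<Rightarrow> nat \<Rightarrow> 'a mat" where
  "mat_block n M i j = submatrix M (index_block n i) (index_block n j)"

end

theory Submission
  imports Defs "Jordan_Normal_Form.Determinant" "HOL-Number_Theory.Cong"
begin

text \<open>
  Let \<open>r\<^sub>0, \<dots>, r\<^sub>m\<close> with \<open>m = n - 1\<close> be the rows of a Hadamard matrix \<open>H\<close>. The rank one
  matrices \<open>C\<^sub>k = r\<^sub>k\<^sup>T r\<^sub>k\<close> are symmetric and satisfy \<open>C\<^sub>k C\<^sub>l = 0\<close> for \<open>k \<noteq> l\<close>,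
  \<open>C\<^sub>k C\<^sub>k = n C\<^sub>k\<close>, and they add up to \<open>H\<^sup>T H = n I\<close>. Arrange \<open>C\<^sub>0, \<dots>, C\<^bsub>m-1\<^esub>\<close> as the blocks
  of a matrix \<open>M\<close> according to the symmetric Latin square \<open>(i + j) mod m\<close>, with a sign \<open>s i j\<close>
  on block \<open>(i, j)\<close>. Then the blocks of \<open>M M\<^sup>T\<close> off the diagonal vanish, and every diagonal
  block is \<open>n (n I - C\<^sub>m)\<close>, whose entries off the diagonal are \<open>n\<close> or \<open>-n\<close>. Taking all signs
  \<open>1\<close> gives a symmetric matrix; signs with \<open>s i j = - s j i\<close> for \<open>i \<noteq> j\<close> give a skew one.
\<close>

section \<open>The signed Latin-square block matrix and its index arithmetic\<close>

definition latin_block_mat :: "nat \<Rightarrow> real mat \<Rightarrow> (nat \<Rightarrow> nat \<Rightarrow> real) \<Rightarrow> real mat" where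
  "latin_block_mat n H s = mat (n * (n - 1)) (n * (n - 1)) (\<lambda>(a, b).
     let k = (a div n + b div n) mod (n - 1)
     in s (a div n) (b div n) * (H $$ (k, a mod n) * H $$ (k, b mod n)))"

lemma dim_latin_block_mat [simp]:
  "dim_row (latin_block_mat n H s) = n * (n - 1)"
  "dim_col (latin_block_mat n H s) = n * (n - 1)"
  by (simp_all add: latin_block_mat_def)

lemma pm1_mat_iff:
  "pm1_mat M \<longleftrightarrow> (\<forall>i<dim_row M. \<forall>j<dim_col M. M $$ (i, j) \<in> {1, - 1})"
proof -
  have "elements_mat M = {M $$ (i, j) |i j. i < dim_row M \<and> j < dim_col M}"
    by (fastforce simp: elements_mat_def)
  then show ?thesis
    unfolding pm1_mat_def by blast
qed

lemma hadamard_mat_entry: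
  assumes "hadamard_mat n H" "k < n" "l < n"
  shows "H $$ (k, l) \<in> {1, - 1}"
  using assms unfolding hadamard_mat_def pm1_mat_iff by blast

text \<open>Every line of the Latin square is a permutation of the residues: translation modulo
  \<open>m\<close> is injective on a finite set it maps to itself. Applied to block rows this
  reindexes a sum over blocks; applied to block columns it separates different block rows.\<close>

lemma bij_betw_add_mod:
  fixes i m :: nat
  assumes "m > 0"
  shows "bij_betw (\<lambda>j. (i + j) mod m) {..<m} {..<m}"
proof -
  have "inj_on (\<lambda>j. (i + j) mod m) {..<m}"
  proof (rule inj_onI)
    fix x y assume xy: "x \<in> {..<m}" "y \<in> {..<m}" "(i + x) mod m = (i + y) mod m"
    then have "[x = y] (mod m)"
      by (simp add: cong_def[symmetric] cong_add_lcancel_nat)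
    then show "x = y"
      using xy by (simp add: cong_def)
  qed
  moreover have "(\<lambda>j. (i + j) mod m) ` {..<m} \<subseteq> {..<m}"
    using assms by auto
  ultimately show ?thesis
    by (simp add: bij_betw_def endo_inj_surj)
qed

text \<open>Splits a sum along a row of the block matrix into block column \<open>j\<close> and
  position \<open>t\<close> inside that block.\<close>

lemma sum_div_mod_nat:
  fixes f :: "nat \<Rightarrow> nat \<Rightarrow> 'a::comm_monoid_add"
  shows "(\<Sum>c<n * m. f (c div n) (c mod n)) = (\<Sum>j<m. \<Sum>t<n. f j t)"
proof -
  have "(\<Sum>c = j * n..<j * n + n. f (c div n) (c mod n)) = (\<Sum>t<n. f j t)" for j
    using sum.shift_bounds_nat_ivl[of "\<lambda>c. f (c div n) (c mod n)" 0 "j * n" n]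
    by (simp add: atLeast0LessThan add.commute)
  then show ?thesis
    by (simp add: sum.nat_group[symmetric] mult.commute)
qed

section \<open>Row and column orthogonality of Hadamard matrices\<close>

lemma hadamard_mat_row_orthogonal:
  assumes "hadamard_mat n H" "k < n" "l < n"
  shows "(\<Sum>t<n. H $$ (k, t) * H $$ (l, t)) = (if k = l then real n else 0)"
proof -
  have H: "H \<in> carrier_mat n n" and eq: "H * transpose_mat H = real n \<cdot>\<^sub>m 1\<^sub>m n"
    using assms(1) by (auto simp: hadamard_mat_def)
  have "(H * transpose_mat H) $$ (k, l) = (\<Sum>t<n. H $$ (k, t) * H $$ (l, t))"
    using H assms(2,3) by (simp add: scalar_prod_def atLeast0LessThan)
  then show ?thesis
    using eq assms(2,3) by (simp split: if_splits)
qed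

text \<open>For \<open>n > 0\<close> the transpose divided by \<open>n\<close> is a right inverse of
  \<open>H\<close>, hence, the matrices being square, also a left inverse. The case
  \<open>n = 0\<close> is split off because of this division.\<close>

lemma hadamard_mat_transpose:
  assumes "hadamard_mat n H"
  shows "hadamard_mat n (transpose_mat H)"
proof (cases "n = 0")
  case True
  then show ?thesis
    using assms by (auto simp: hadamard_mat_def pm1_mat_iff)
next
  case False
  have H: "H \<in> carrier_mat n n" and eq: "H * transpose_mat H = real n \<cdot>\<^sub>m 1\<^sub>m n"
    using assms by (auto simp: hadamard_mat_def)
  have "H * ((1 / real n) \<cdot>\<^sub>m transpose_mat H) = 1\<^sub>m n"
    using H eq False by (subst mult_smult_distrib[of _ n n _ n]) auto
  then have "((1 / real n) \<cdot>\<^sub>m transpose_mat H) * H = 1\<^sub>m n"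
    using H by (subst mat_mult_left_right_inverse[of H n]) simp_all
  then have *: "(1 / real n) \<cdot>\<^sub>m (transpose_mat H * H) = 1\<^sub>m n"
    using H by (simp add: mult_smult_assoc_mat[of _ n n _ n])
  have "transpose_mat H * H = real n \<cdot>\<^sub>m ((1 / real n) \<cdot>\<^sub>m (transpose_mat H * H))"
    using False by auto
  then have "transpose_mat H * H = real n \<cdot>\<^sub>m 1\<^sub>m n"
    unfolding * .
  moreover have "pm1_mat (transpose_mat H)"
    using assms H by (auto simp: hadamard_mat_def pm1_mat_iff)
  ultimately show ?thesis
    using H by (simp add: hadamard_mat_def)
qed

lemma hadamard_mat_col_orthogonal:
  assumes "hadamard_mat n H" "k < n" "l < n"
  shows "(\<Sum>t<n. H $$ (t, k) * H $$ (t, l)) = (if k = l then real n else 0)"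
proof -
  have "H \<in> carrier_mat n n"
    using assms(1) by (simp add: hadamard_mat_def)
  then have "(\<Sum>t<n. H $$ (t, k) * H $$ (t, l)) =
      (\<Sum>t<n. transpose_mat H $$ (k, t) * transpose_mat H $$ (l, t))"
    using assms(2,3) by (intro sum.cong) auto
  then show ?thesis
    using hadamard_mat_row_orthogonal[OF hadamard_mat_transpose] assms by simp
qed

section \<open>Entries and row inner products of the block matrix\<close>

lemma index_latin_block_mat:
  assumes "a < n * (n - 1)" "b < n * (n - 1)"
  shows "latin_block_mat n H s $$ (a, b) = s (a div n) (b div n) *
    (H $$ ((a div n + b div n) mod (n - 1), a mod n) *
     H $$ ((a div n + b div n) mod (n - 1), b mod n))"
  using assms by (simp add: latin_block_mat_def Let_def)

lemma pm1_latin_block_mat: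
  assumes "hadamard_mat n H" "\<And>i j. s i j \<in> {1, - 1}"
  shows "pm1_mat (latin_block_mat n H s)"
proof -
  have "latin_block_mat n H s $$ (a, b) \<in> {1, - 1}"
    if ab: "a < n * (n - 1)" "b < n * (n - 1)" for a b
  proof -
    let ?k = "(a div n + b div n) mod (n - 1)"
    have n: "n > 0" "n - 1 > 0"
      using ab by (cases n; cases "n - 1"; simp)+
    then have "?k < n - 1"
      by (intro mod_less_divisor)
    then have "?k < n"
      by simp
    then have "H $$ (?k, a mod n) \<in> {1, - 1}" "H $$ (?k, b mod n) \<in> {1, - 1}"
      using hadamard_mat_entry[OF assms(1)] n by simp_all
    then show ?thesis
      using assms(2)[of "a div n" "b div n"] ab by (auto simp: index_latin_block_mat)
  qed
  then show ?thesis
    by (simp add: pm1_mat_iff)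
qed

lemma row_scalar_prod_latin_block_mat:
  assumes H: "hadamard_mat n H" and s: "\<And>i j. s i j \<in> {1, - 1}"
    and ab: "a < n * (n - 1)" "b < n * (n - 1)"
  shows "row (latin_block_mat n H s) a \<bullet> row (latin_block_mat n H s) b =
    (if a div n = b div n
     then real n * ((if a = b then real n else 0) -
       H $$ (n - 1, a mod n) * H $$ (n - 1, b mod n))
     else 0)"
proof -
  define m where "m = n - 1"
  define k where "k i j = (i + j) mod m" for i j
  let ?i = "a div n" and ?i' = "b div n" and ?p = "a mod n" and ?q = "b mod n"
  have n: "n > 0" "m > 0" "n = Suc m"
    using ab by (cases n; cases m; simp add: m_def)+
  have div_less: "?i < m" "?i' < m"
    using ab by (simp_all add: m_def less_mult_imp_div_less mult.commute)
  have k_less: "k i j < n" for i j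
    using n by (simp add: k_def less_Suc_eq)
  \<comment> \<open>Adding the fixed \<open>j\<close> is injective modulo \<open>m\<close>, so in
    one block column different block rows carry different rows of \<open>H\<close>. This makes the
    products between different classes vanish.\<close>
  have k_eq_iff: "k ?i j = k ?i' j \<longleftrightarrow> ?i = ?i'" if "j < m" for j
    using inj_on_eq_iff[OF bij_betw_imp_inj_on[OF bij_betw_add_mod[OF n(2)]], of ?i ?i' j] div_less
    by (simp add: k_def add.commute[of _ j])
  have "row (latin_block_mat n H s) a \<bullet> row (latin_block_mat n H s) b =
      (\<Sum>c<n * m. s ?i (c div n) * (H $$ (k ?i (c div n), ?p) * H $$ (k ?i (c div n), c mod n)) *
        (s ?i' (c div n) * (H $$ (k ?i' (c div n), ?q) * H $$ (k ?i' (c div n), c mod n))))"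
    using ab by (simp add: scalar_prod_def atLeast0LessThan index_latin_block_mat m_def k_def)
  also have "\<dots> = (\<Sum>j<m. \<Sum>t<n. s ?i j * (H $$ (k ?i j, ?p) * H $$ (k ?i j, t)) *
        (s ?i' j * (H $$ (k ?i' j, ?q) * H $$ (k ?i' j, t))))"
    by (rule sum_div_mod_nat)
  also have "\<dots> = (\<Sum>j<m. s ?i j * s ?i' j * (H $$ (k ?i j, ?p) * H $$ (k ?i' j, ?q)) *
        (\<Sum>t<n. H $$ (k ?i j, t) * H $$ (k ?i' j, t)))"
    \<comment> \<open>The factors independent of \<open>t\<close> come out, leaving an inner product
      of two rows of \<open>H\<close> for each block column.\<close>
    by (simp add: sum_distrib_left mult_ac)
  also have "\<dots> = (\<Sum>j<m. s ?i j * s ?i' j * (H $$ (k ?i j, ?p) * H $$ (k ?i' j, ?q)) *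
        (if ?i = ?i' then real n else 0))"
    using hadamard_mat_row_orthogonal[OF H k_less k_less] k_eq_iff by (intro sum.cong) auto
  also have "\<dots> = (if ?i = ?i'
      then real n * (\<Sum>j<m. H $$ (k ?i j, ?p) * H $$ (k ?i j, ?q)) else 0)"
  proof -
    \<comment> \<open>Within one class both rows meet the same sign in each block, and it squares to
      1. The nested form matches the products as \<open>mult_ac\<close> arranges them.\<close>
    have sign: "s i j * (s i j * x) = x" for i j x
      using s[of i j] by auto
    show ?thesis
      by (simp add: sum_distrib_left mult_ac sign)
  qed
  also have "(\<Sum>j<m. H $$ (k ?i j, ?p) * H $$ (k ?i j, ?q)) =
      (\<Sum>l<m. H $$ (l, ?p) * H $$ (l, ?q))"
    unfolding k_def by (rule sum.reindex_bij_betw[OF bij_betw_add_mod[OF n(2)]])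
  \<comment> \<open>Since \<open>n = Suc m\<close>, the blocks supply every row of \<open>H\<close>
    except row \<open>m\<close>; subtracting its term from the full column product brings in column
    orthogonality.\<close>
  also have "\<dots> = (\<Sum>l<n. H $$ (l, ?p) * H $$ (l, ?q)) - H $$ (m, ?p) * H $$ (m, ?q)"
    by (simp add: n(3))
  also have "(\<Sum>l<n. H $$ (l, ?p) * H $$ (l, ?q)) = (if ?p = ?q then real n else 0)"
    using n by (intro hadamard_mat_col_orthogonal[OF H]) simp_all
  finally have "row (latin_block_mat n H s) a \<bullet> row (latin_block_mat n H s) b =
      (if ?i = ?i' then real n * ((if ?p = ?q then real n else 0) -
        H $$ (m, ?p) * H $$ (m, ?q)) else 0)" .
  moreover have "?p = ?q \<longleftrightarrow> a = b" if "?i = ?i'"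
    using that by (metis div_mult_mod_eq)
  ultimately show ?thesis
    by (simp add: m_def)
qed

lemma row_angle_latin_block_mat:
  assumes H: "hadamard_mat n H" and s: "\<And>i j. s i j \<in> {1, - 1}"
    and ab: "a < n * (n - 1)" "b < n * (n - 1)" "a \<noteq> b"
  shows "row_angle (latin_block_mat n H s) a b =
    (if a div n = b div n then 1 / (real n - 1) else 0)"
proof -
  let ?M = "latin_block_mat n H s"
  have n: "n > 1"
    using ab(1) by (cases n) (auto intro: Nat.gr0I)
  have Hpm: "H $$ (n - 1, t mod n) \<in> {1, - 1}" for t
    using hadamard_mat_entry[OF H] n by simp
  \<comment> \<open>At equal indices the subtracted product is the square of an entry \<plusminus>1.
    So all rows have the same norm, and the two normalizing square roots multiply to
    \<open>n * (n - 1)\<close>.\<close>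
  have norm: "row ?M c \<bullet> row ?M c = real n * (real n - 1)" if "c < n * (n - 1)" for c
    using row_scalar_prod_latin_block_mat[OF H s that that] Hpm[of c] by auto
  have "row_angle ?M a b = \<bar>row ?M a \<bullet> row ?M b\<bar> / (real n * (real n - 1))"
    using n ab norm
    by (simp add: row_angle_def normalized_row_def abs_mult real_sqrt_mult[symmetric]
        flip: power2_eq_square)
  moreover have "\<bar>H $$ (n - 1, a mod n) * H $$ (n - 1, b mod n)\<bar> = 1"
    using Hpm[of a] Hpm[of b] by auto
  ultimately show ?thesis
    using row_scalar_prod_latin_block_mat[OF H s ab(1,2)] ab(3) n by (simp add: abs_mult)
qed

section \<open>The partition into consecutive blocks and regularity\<close>

lemma mem_index_block_iff:
  assumes "n > 0"
  shows "a \<in> index_block n i \<longleftrightarrow> a div n = i"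
  using assms by (auto simp: index_block_def dividend_less_times_div div_nat_eqI
      less_mult_imp_div_less mult.commute)

lemma inj_index_block:
  assumes "n > 0"
  shows "inj (index_block n)"
proof (rule injI)
  fix i j assume "index_block n i = index_block n j"
  moreover have "i * n \<in> index_block n i"
    using assms by (simp add: mem_index_block_iff)
  ultimately have "i * n \<in> index_block n j"
    by simp
  then show "i = j"
    using assms by (simp add: mem_index_block_iff)
qed

lemma card_index_block [simp]: "card (index_block n i) = n"
  by (simp add: index_block_def)

lemma partition_on_index_block:
  assumes "n > 0"
  shows "partition_on {..<n * m} (index_block n ` {..<m})"
proof (rule partition_onI)
  have "a \<in> \<Union> (index_block n ` {..<m}) \<longleftrightarrow> a div n < m" for a
    by (simp add: mem_index_block_iff[OF assms])
  also have "a div n < m \<longleftrightarrow> a < n * m" for a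
    using assms by (simp add: div_less_iff_less_mult mult.commute)
  finally show "\<Union> (index_block n ` {..<m}) = {..<n * m}"
    by blast
  show "{} \<notin> index_block n ` {..<m}"
    \<comment> \<open>An empty class would have cardinality 0, whereas every block has
      \<open>n > 0\<close> elements.\<close>
    using assms by (auto dest!: arg_cong[of _ _ card])
  show "disjnt p q"
    if "p \<in> index_block n ` {..<m}" "q \<in> index_block n ` {..<m}" "p \<noteq> q" for p q
    using that assms by (auto simp: disjnt_def mem_index_block_iff)
qed

lemma regular_biangular_latin_block_mat:
  assumes n: "n > 0" and H: "hadamard_mat n H" and s: "\<And>i j. s i j \<in> {1, - 1}"
  shows "regular_biangular (index_block n ` {..<n - 1}) n (1 / (real n - 1)) 0
    (latin_block_mat n H s)"
proof -
  let ?M = "latin_block_mat n H s"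
  have angle: "row_angle ?M a b = (if a div n = b div n then 1 / (real n - 1) else 0)"
    if "a < n * (n - 1)" "b < n * (n - 1)" "a \<noteq> b" for a b
    using row_angle_latin_block_mat[OF H s that] .
  have lt: "a < n * (n - 1)" if "a div n < n - 1" for a
    using that n by (simp add: div_less_iff_less_mult mult.commute)
  have "biangular (1 / (real n - 1)) 0 ?M"
    using pm1_latin_block_mat[OF H s] angle by (auto simp: biangular_def)
  moreover have "row_angle ?M a b = 1 / (real n - 1)"
    if "i < n - 1" "a \<in> index_block n i" "b \<in> index_block n i" "a \<noteq> b" for i a b
    using that n lt angle[of a b] by (auto simp: mem_index_block_iff)
  moreover have "row_angle ?M a b = 0"
    if "i < n - 1" "j < n - 1" "index_block n i \<noteq> index_block n j"
      "a \<in> index_block n i" "b \<in> index_block n j" for i j a b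
  proof -
    have "a div n = i" "b div n = j" "i \<noteq> j"
      using that n by (auto simp: mem_index_block_iff)
    then show ?thesis
      using that(1,2) angle[OF lt lt, of a b] by auto
  qed
  ultimately show ?thesis
    using partition_on_index_block[OF n, of "n - 1"] by (auto simp: regular_biangular_def)
qed

section \<open>Symmetry, block access and skew-symmetry\<close>

lemma transpose_latin_block_mat:
  assumes "\<And>i j. s i j = s j i"
  shows "transpose_mat (latin_block_mat n H s) = latin_block_mat n H s"
  using assms by (intro eq_matI) (auto simp: index_latin_block_mat add.commute mult_ac)

text \<open>\<open>submatrix_index_card\<close> addresses an entry by the number of selected indices
  below it; this count recovers the offset inside the block.\<close>

lemma card_index_block_less:
  assumes "t < n"
  shows "card {a \<in> index_block n i. a < i * n + t} = t"
proof -
  have "{a \<in> index_block n i. a < i * n + t} = {i * n..<i * n + t}"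
    using assms by (auto simp: index_block_def)
  then show ?thesis
    by simp
qed

lemma block_index_less:
  fixes i n m t :: nat
  assumes "i < m" "t < n"
  shows "i * n + t < n * m"
proof -
  have "i * n + t < Suc i * n"
    using assms(2) by simp
  also have "\<dots> \<le> m * n"
    using assms(1) by (intro mult_le_mono1) simp
  finally show ?thesis
    by (simp add: mult.commute)
qed

lemma dim_mat_block:
  assumes "M \<in> carrier_mat (n * m) (n * m)" "i < m" "j < m"
  shows "mat_block n M i j \<in> carrier_mat n n"
proof -
  \<comment> \<open>\<open>submatrix\<close> keeps only those selected indices that lie inside the
    matrix; for \<open>i < m\<close> nothing of the block is cut off.\<close>
  have "{a. a < n * m \<and> a \<in> index_block n i} = index_block n i" if "i < m" for i
  proof -
    have "(i + 1) * n \<le> m * n"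
      using that by (intro mult_le_mono1) simp
    then show ?thesis
      by (auto simp: index_block_def mult.commute)
  qed
  then show ?thesis
    using assms by (auto simp: mat_block_def dim_submatrix intro!: carrier_matI)
qed

lemma index_mat_block:
  assumes "M \<in> carrier_mat (n * m) (n * m)" "i < m" "j < m" "t < n" "u < n"
  shows "mat_block n M i j $$ (t, u) = M $$ (i * n + t, j * n + u)"
proof -
  have "i * n + t \<in> index_block n i" "j * n + u \<in> index_block n j"
    using assms by (auto simp: index_block_def)
  then show ?thesis
    using submatrix_index_card[of "i * n + t" M "j * n + u" "index_block n i" "index_block n j"]
      assms block_index_less by (simp add: mat_block_def card_index_block_less)
qed

text \<open>Blocks \<open>(i, j)\<close> and \<open>(j, i)\<close> hold the same symmetric rank one
  matrix, because \<open>i + j = j + i\<close>; they differ only in sign.\<close>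

lemma transpose_mat_block_latin_block_mat:
  assumes s: "s j i = - s i j" and ij: "i < n - 1" "j < n - 1"
  shows "transpose_mat (mat_block n (latin_block_mat n H s) i j) =
    - mat_block n (latin_block_mat n H s) j i"
proof -
  let ?M = "latin_block_mat n H s"
  have M: "?M \<in> carrier_mat (n * (n - 1)) (n * (n - 1))"
    by (simp add: carrier_matI)
  note block = dim_mat_block[OF M ij] dim_mat_block[OF M ij(2,1)]
  show ?thesis
  proof (rule eq_matI)
    fix t u
    assume "t < dim_row (- mat_block n ?M j i)" "u < dim_col (- mat_block n ?M j i)"
    then have tu: "t < n" "u < n"
      using block by auto
    show "transpose_mat (mat_block n ?M i j) $$ (t, u) = (- mat_block n ?M j i) $$ (t, u)"
      using block tu ij s
      by (simp add: index_mat_block[OF M] index_latin_block_mat block_index_less add.commute[of j i])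
  qed (use block in auto)
qed

theorem theorem5p2:
  fixes n :: nat
  assumes "n > 0"
    and "\<exists>H. hadamard_mat n H"
  shows
    "(\<exists>M P. M \<in> carrier_mat (n * (n - 1)) (n * (n - 1)) \<and>
        transpose_mat M = M \<and>
        card P = n - 1 \<and>
        regular_biangular P n (1 / (real n - 1)) 0 M) \<and>
     (\<exists>M. M \<in> carrier_mat (n * (n - 1)) (n * (n - 1)) \<and>
        regular_biangular (index_block n ` {..<n - 1}) n (1 / (real n - 1)) 0 M \<and>
        (\<forall>i < n - 1. \<forall>j < n - 1. i \<noteq> j \<longrightarrow>
           transpose_mat (mat_block n M i j) = - mat_block n M j i))"
proof -
  from assms(2) obtain H where H: "hadamard_mat n H"
    by blast
  define A where "A = latin_block_mat n H (\<lambda>_ _. 1)"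
  \<comment> \<open>The sign is -1 above the block diagonal and 1 below it, so it flips under
    exchange of distinct \<open>i\<close>, \<open>j\<close>. Diagonal blocks get 1, which keeps all
    entries \<plusminus>1.\<close>
  define B where "B = latin_block_mat n H (\<lambda>i j. if i < j then - 1 else 1)"
  have "A \<in> carrier_mat (n * (n - 1)) (n * (n - 1))" "transpose_mat A = A"
    by (simp_all add: A_def carrier_matI transpose_latin_block_mat)
  moreover have "card (index_block n ` {..<n - 1}) = n - 1"
    \<comment> \<open>Blocks with different numbers are different sets because \<open>n > 0\<close>,
      so no classes coincide in the image.\<close>
    using inj_on_subset[OF inj_index_block[OF assms(1)] subset_UNIV] by (simp add: card_image)
  moreover have "regular_biangular (index_block n ` {..<n - 1}) n (1 / (real n - 1)) 0 A"
    unfolding A_def by (rule regular_biangular_latin_block_mat[OF assms(1) H]) simp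
  moreover have "B \<in> carrier_mat (n * (n - 1)) (n * (n - 1))"
    by (simp add: B_def carrier_matI)
  moreover have "regular_biangular (index_block n ` {..<n - 1}) n (1 / (real n - 1)) 0 B"
    unfolding B_def by (rule regular_biangular_latin_block_mat[OF assms(1) H]) simp
  moreover have "transpose_mat (mat_block n B i j) = - mat_block n B j i"
    if "i < n - 1" "j < n - 1" "i \<noteq> j" for i j
    unfolding B_def by (rule transpose_mat_block_latin_block_mat) (use that in auto)
  ultimately show ?thesis
    by blast
qed

end
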